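(* Let $T$ be a rank-one transformation constructed by cutting each column $C_n$ in half and, at every step $n$, adding $c_n\ge 2h_n$ spacers on top of the right subcolumn (and none on top of the left subcolumn); that is, $r_n=2$, $s_{n,0}=0$ and $s_{n,1}=c_n\ge 2h_n$ for all $n\ge 0$. Then $T$ is not rationally weakly mixing.
   Context: Rank-one transformations. A column is a finite ordered collection of pairwise disjoint intervals of $\mathbb{R}$ (called levels), all of the same length, thought of as stacked on top of each other. The column map $T_C$ of a column $C$ sends each point of a level other than the top one to the point directly above it in the next level (by translation); it is undefined on the top level. A rank-one (cutting-and-stacking) transformation $T$ is given by a sequence of columns $C_n$, $n\ge 0$: $C_0$ consists of the single level $I=(0,1)$; $C_{n+1}$ is obtained from $C_n$ by cutting $C_n$ into $r_n\ge 2$ subcolumns of equal width (numbered $0,\dots,r_n-1$ from left to right), adding $s_{n,k}\ge 0$ new levels ("spacers", new disjoint intervals) above the $k$-th subcolumn, and stacking every subcolumn under the subcolumn to its right. $X$ is the union of all levels of all columns, with Lebesgue measure $\mu$ and its Borel $\sigma$-algebra, and the levels are required to form a generating semiring for the $\sigma$-algebra. $T_{C_{n+1}}$ extends $T_{C_n}$, and $T$ is the limit of the $T_{C_n}$; it is an invertible measure-preserving transformation of $X$ (mod null sets). $h_n$ denotes the number of levels of $C_n$. For measurable $F$ with $0<\mu(F)<\infty$, $u_k(F)=\mu(F\cap T^kF)/\mu(F)^2$ and $a_n(F)=\sum_{k=0}^{n-1}u_k(F)$. $T$ is rationally weakly mixing if there exists a measurable $F\subset X$ with $0<\mu(F)<\infty$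 such that for all measurable $A,B\subset F$, $$\frac{1}{a_n(F)}\sum_{k=0}^{n-1}\left|\mu(A\cap T^kB)-\mu(A)\mu(B)u_k(F)\right|\to 0\quad\text{as } n\to\infty.$$ *)

theory Defs
  imports "HOL-Analysis.Analysis"
begin

text \<open>
  Columns are encoded by the common width of their levels and the list of the left endpoints of
  the levels, from bottom to top.  Levels are open intervals, so that the initial level is
  \<open>(0,1)\<close>; the finitely many endpoints produced by a cut belong to no level of the new column.
  All of this is modulo null sets, as usual.
\<close>

datatype column = Column (width: real) (bases: "real list")

definition height :: "column \<Rightarrow> nat" where
  "height C = length (bases C)"

definition level :: "column \<Rightarrow> nat \<Rightarrow> real set" where
  "level C i = {bases C ! i <..< bases C ! i + width C}"

definition is_column :: "column \<Rightarrow> bool" where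
  "is_column C \<longleftrightarrow> 0 < height C \<and> 0 < width C \<and> disjoint_family_on (level C) {..<height C}"

text \<open>The column map is given by its graph, being undefined on the top level.\<close>

definition column_map :: "column \<Rightarrow> (real \<times> real) set" where
  "column_map C =
     {(x, x - bases C ! i + bases C ! Suc i) | x i. Suc i < height C \<and> x \<in> level C i}"

definition subcolumn :: "nat \<Rightarrow> column \<Rightarrow> nat \<Rightarrow> real list" where
  "subcolumn r C k = map (\<lambda>b. b + real k * (width C / real r)) (bases C)"

text \<open>
  In \<open>cut_and_stack r s C C'\<close>, the list \<open>sp k\<close> consists of the left endpoints of the \<open>s k\<close> spacers
  above the \<open>k\<close>-th subcolumn.  The position of the spacers is otherwise arbitrary.  As levels
  are open intervals, \<open>is_column C'\<close> forces the spacers to be disjoint from the levels of \<open>C\<close>,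
  and not only from those of the subcolumns.
\<close>

definition cut_and_stack :: "nat \<Rightarrow> (nat \<Rightarrow> nat) \<Rightarrow> column \<Rightarrow> column \<Rightarrow> bool" where
  "cut_and_stack r s C C' \<longleftrightarrow>
     is_column C' \<and> width C' = width C / real r \<and>
     (\<exists>sp :: nat \<Rightarrow> real list.
        (\<forall>k<r. length (sp k) = s k) \<and>
        bases C' = concat (map (\<lambda>k. subcolumn r C k @ sp k) [0..<r]))"

definition levels :: "(nat \<Rightarrow> column) \<Rightarrow> real set set" where
  "levels C = {level (C n) i | n i. i < height (C n)}"

definition rank_one_space :: "(nat \<Rightarrow> column) \<Rightarrow> real measure" where
  "rank_one_space C = restrict_space lborel (\<Union>(levels C))"

definition generating_semiring :: "'a measure \<Rightarrow> 'a set set \<Rightarrow> bool" where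
  "generating_semiring M S \<longleftrightarrow>
     S \<subseteq> sets M \<and>
     (\<forall>A\<in>S. \<forall>B\<in>S.
        (\<exists>D\<in>insert {} S. sym_diff (A \<inter> B) D \<in> null_sets M) \<and>
        (\<exists>\<D>. finite \<D> \<and> \<D> \<subseteq> S \<and> disjoint \<D> \<and> sym_diff (A - B) (\<Union>\<D>) \<in> null_sets M)) \<and>
     (\<forall>A\<in>sets M. \<exists>B\<in>sigma_sets (space M) S. sym_diff A B \<in> null_sets M)"

definition rank_one_columns ::
    "(nat \<Rightarrow> nat) \<Rightarrow> (nat \<Rightarrow> nat \<Rightarrow> nat) \<Rightarrow> (nat \<Rightarrow> column) \<Rightarrow> bool" where
  "rank_one_columns r s C \<longleftrightarrow>
     C 0 = Column 1 [0] \<and>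
     (\<forall>n. 2 \<le> r n \<and> cut_and_stack (r n) (s n) (C n) (C (Suc n))) \<and>
     generating_semiring (rank_one_space C) (levels C)"

text \<open>
  The limit of the column maps has as its graph the union of their graphs (which is
  single-valued, since the column maps agree wherever they are defined).  The remaining points
  of the space form a null set, on which the map is set to be the identity.
\<close>

definition rank_one_map :: "(nat \<Rightarrow> column) \<Rightarrow> real \<Rightarrow> real" where
  "rank_one_map C x =
     (if x \<in> Domain (\<Union>n. column_map (C n)) then THE y. (x, y) \<in> (\<Union>n. column_map (C n)) else x)"

definition return_rate :: "'a measure \<Rightarrow> ('a \<Rightarrow> 'a) \<Rightarrow> 'a set \<Rightarrow> nat \<Rightarrow> real" where
  "return_rate M T F k = measure M (F \<inter> (T ^^ k) ` F) / (measure M F)\<^sup>2"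

definition return_sequence :: "'a measure \<Rightarrow> ('a \<Rightarrow> 'a) \<Rightarrow> 'a set \<Rightarrow> nat \<Rightarrow> real" where
  "return_sequence M T F n = (\<Sum>k<n. return_rate M T F k)"

text \<open>
  Meant for transformations that are invertible and measure preserving modulo null sets, with
  measurable images of measurable sets.
\<close>

definition rationally_weakly_mixing :: "'a measure \<Rightarrow> ('a \<Rightarrow> 'a) \<Rightarrow> bool" where
  "rationally_weakly_mixing M T \<longleftrightarrow>
     (\<exists>F\<in>sets M. 0 < emeasure M F \<and> emeasure M F < \<infinity> \<and>
        (\<forall>A\<in>sets M. \<forall>B\<in>sets M. A \<subseteq> F \<longrightarrow> B \<subseteq> F \<longrightarrow>
           (\<lambda>n. 1 / return_sequence M T F n *
                (\<Sum>k<n. \<bar>measure M (A \<inter> (T ^^ k) ` B)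
                         - measure M A * measure M B * return_rate M T F k\<bar>))
           \<longlonglongrightarrow> 0))"

end

theory Submission
  imports Defs
begin

text \<open>
  Almost every point of a level \<open>i\<close> of \<open>C\<^sub>m\<close> lies, in every later column \<open>C\<^sub>n\<close>, at a height
  \<open>i + (\<Sum>m\<le>j<n. \<epsilon>\<^sub>j h\<^sub>j)\<close> with digits \<open>\<epsilon>\<^sub>j \<in> {0,1}\<close>, where \<open>\<epsilon>\<^sub>j\<close> tells whether the cut of \<open>C\<^sub>j\<close>
  puts it into the left or the right half.  Hence a return time of the level has the form
  \<open>\<Sum>m\<le>j<n. \<eta>\<^sub>j h\<^sub>j\<close> with \<open>\<eta>\<^sub>j \<in> {-1,0,1}\<close>, and these digits are unique because \<open>h\<^sub>j\<^sub>+\<^sub>1 \<ge> 4 h\<^sub>j\<close>.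
  If \<open>A\<close> and \<open>B\<close> are contained in the left and the right half of the level, then
  \<open>\<mu>(A \<inter> T\<^sup>k A) > 0\<close> forces \<open>\<eta>\<^sub>m = 0\<close> and \<open>\<mu>(A \<inter> T\<^sup>k B) > 0\<close> forces \<open>\<eta>\<^sub>m = -1\<close>, so for each \<open>k\<close> one
  of the two measures vanishes.  For \<open>A, B \<subseteq> F\<close> of positive measure this keeps the two averages
  in the definition of rational weak mixing from both tending to \<open>0\<close>; and every \<open>F\<close> of positive
  measure meets both halves of some level in positive measure, since the widths tend to \<open>0\<close>.
\<close>

section \<open>Subset sums of rapidly growing sequences\<close>

primrec subset_sums :: "(nat \<Rightarrow> nat) \<Rightarrow> nat \<Rightarrow> nat set" where
  "subset_sums g 0 = {0}"
| "subset_sums g (Suc k) = subset_sums g k \<union> (+) (g k) ` subset_sums g k"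

text \<open>Since 1/4 + 1/16 + ... = 1/3, growth by the factor 4 keeps the sum of all earlier terms
  at most a third of \<open>g k\<close>; \<open>d\<close> acts as a term preceding
  \<open>g 0\<close>.\<close>

lemma subset_sums_bound:
  assumes "4 * d \<le> g 0" "\<And>k. 4 * g k \<le> g (Suc k)" "s \<in> subset_sums g k"
  shows "3 * (s + d) \<le> g k"
  using assms(3)
proof (induction k arbitrary: s)
  case 0
  then show ?case using assms(1) by simp
next
  case (Suc k)
  then obtain t where t: "t \<in> subset_sums g k" "s = t \<or> s = g k + t"
    by auto
  then show ?case using Suc.IH[OF t(1)] assms(2)[of k] by auto
qed

text \<open>This is the uniqueness of signed digits, for the differences \<open>s1 - s2\<close> and
  \<open>s3 - s4\<close> and the extra place \<open>d\<close> below \<open>g 0\<close>. The sums on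
  both sides avoid truncated subtraction on \<open>nat\<close>.\<close>

lemma subset_sums_separated:
  assumes "0 < d" "4 * d \<le> g 0" "\<And>k. 4 * g k \<le> g (Suc k)"
    and "s1 \<in> subset_sums g k" "s2 \<in> subset_sums g k"
    and "s3 \<in> subset_sums g k" "s4 \<in> subset_sums g k"
  shows "s1 + s4 + d \<noteq> s2 + s3"
  using assms(4-)
proof (induction k arbitrary: s1 s2 s3 s4)
  case 0
  then show ?case using assms(1) by simp
next
  case (Suc k)
  have split: "\<exists>t\<in>subset_sums g k. s = t \<or> s = g k + t" if "s \<in> subset_sums g (Suc k)" for s
    using that by auto
  obtain t1 t2 t3 t4 where t: "t1 \<in> subset_sums g k" "t2 \<in> subset_sums g k"
      "t3 \<in> subset_sums g k" "t4 \<in> subset_sums g k"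
    and s: "s1 = t1 \<or> s1 = g k + t1" "s2 = t2 \<or> s2 = g k + t2"
      "s3 = t3 \<or> s3 = g k + t3" "s4 = t4 \<or> s4 = g k + t4"
    using Suc.prems[THEN split] by blast
  \<comment> \<open>The lower terms on either side total less than \<open>g k\<close>, so in an
    equality \<open>g k\<close> would occur equally often on both sides and cancel.\<close>
  have bounds: "3 * (t1 + d) \<le> g k" "3 * (t2 + d) \<le> g k" "3 * (t3 + d) \<le> g k" "3 * (t4 + d) \<le> g k"
    by (rule subset_sums_bound[OF assms(2,3)], rule t)+
  have "t1 + t4 + d \<noteq> t2 + t3"
    using Suc.IH t by blast
  then show ?case
    using s bounds assms(1) by auto
qed

section \<open>Widths, heights and levels of the columns\<close>

locale cut_in_half =
  fixes C :: "nat \<Rightarrow> column" and c :: "nat \<Rightarrow> nat"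
  assumes column_0: "C 0 = Column 1 [0]"
    and is_column_Suc: "is_column (C (Suc n))"
    and width_Suc: "width (C (Suc n)) = width (C n) / 2"
    and bases_Suc: "\<exists>sp. length sp = c n \<and>
      bases (C (Suc n)) = bases (C n) @ map (\<lambda>b. b + width (C n) / 2) (bases (C n)) @ sp"
    and spacers: "2 * height (C n) \<le> c n"
begin

abbreviation h :: "nat \<Rightarrow> nat" where "h n \<equiv> height (C n)"
abbreviation w :: "nat \<Rightarrow> real" where "w n \<equiv> width (C n)"
abbreviation base :: "nat \<Rightarrow> nat \<Rightarrow> real" where "base n i \<equiv> bases (C n) ! i"
abbreviation lev :: "nat \<Rightarrow> nat \<Rightarrow> real set" where "lev n \<equiv> level (C n)"
abbreviation X :: "real set" where "X \<equiv> \<Union>(levels C)"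
abbreviation M :: "real measure" where "M \<equiv> rank_one_space C"
abbreviation T :: "real \<Rightarrow> real" where "T \<equiv> rank_one_map C"

lemma width_eq: "w n = 1 / 2 ^ n"
  by (induction n) (simp_all add: column_0 width_Suc)

lemma width_pos: "0 < w n"
  by (simp add: width_eq)

lemma is_column: "is_column (C n)"
proof (cases n)
  case 0
  then show ?thesis
    by (simp add: is_column_def column_0 height_def disjoint_family_on_def)
qed (simp add: is_column_Suc)

lemma height_pos: "0 < h n"
  using is_column by (simp add: is_column_def)

lemma height_Suc: "h (Suc n) = 2 * h n + c n"
  using bases_Suc[of n] by (auto simp: height_def)

text \<open>The spacer bound enters the argument through this factor 4, on which the uniqueness of
  digits rests.\<close>

lemma height_growth: "4 * h n \<le> h (Suc n)"
  using height_Suc[of n] spacers[of n] by simp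

lemma height_ge: "n \<le> h n"
proof (induction n)
  case (Suc n)
  then show ?case using height_growth[of n] height_pos[of n] by linarith
qed simp

lemma base_left: "i < h n \<Longrightarrow> base (Suc n) i = base n i"
  using bases_Suc[of n] by (auto simp: height_def nth_append)

text \<open>With no spacers above the left subcolumn, the right one starts at height exactly
  \<open>h n\<close>; so a digit 1 adds \<open>h n\<close> to the height of a point.\<close>

lemma base_right: "i < h n \<Longrightarrow> base (Suc n) (i + h n) = base n i + w n / 2"
  using bases_Suc[of n] by (auto simp: height_def nth_append)

lemma level_unique:
  assumes "x \<in> lev n i" "x \<in> lev n j" "i < h n" "j < h n"
  shows "i = j"
proof (rule ccontr)
  assume "i \<noteq> j"
  then have "lev n i \<inter> lev n j = {}"
    using is_column[of n] assms(3,4) by (auto simp: is_column_def disjoint_family_on_def)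
  then show False using assms(1,2) by blast
qed

text \<open>
  A later spacer may cover a midpoint lost in a cut, so the column maps need not agree there.
  The bad points are the translates of midpoints: the orbit of any other point avoids midpoints.
\<close>

definition midpoints :: "real set" where
  "midpoints = (\<lambda>(n, i). base n i + w n / 2) ` UNIV"

lemma countable_midpoints: "countable midpoints"
  by (simp add: midpoints_def)

definition bad_points :: "real set" where
  "bad_points = (\<lambda>(e, n, i, j). e + base n i - base n j) ` (midpoints \<times> UNIV)"

lemma countable_bad_points: "countable bad_points"
  unfolding bad_points_def by (intro countable_image countable_SIGMA countable_midpoints) auto

lemma translate_notin_midpoints:
  assumes "x \<notin> bad_points"
  shows "x - base n i + base n j \<notin> midpoints"
proof
  assume "x - base n i + base n j \<in> midpoints"
  then have "(x - base n i + base n j) + base n i - base n j \<in> bad_points"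
    unfolding bad_points_def by (intro image_eqI[where x = "(x - base n i + base n j, n, i, j)"]) auto
  then show False using assms by simp
qed

section \<open>Locating points in later columns\<close>

lemma level_split:
  assumes "i < h n"
  shows "lev n i \<subseteq> lev (Suc n) i \<union> lev (Suc n) (i + h n) \<union> midpoints"
proof
  fix x assume x: "x \<in> lev n i"
  have "base n i + w n / 2 \<in> midpoints"
    unfolding midpoints_def by (rule image_eqI[where x = "(n, i)"]) auto
  then show "x \<in> lev (Suc n) i \<union> lev (Suc n) (i + h n) \<union> midpoints"
    using x by (cases "x = base n i + w n / 2")
      (auto simp: level_def base_left[OF assms] base_right[OF assms] width_Suc)
qed

text \<open>Each cut contributes one digit: the left half keeps its height, the right half gains
  \<open>h (m + k)\<close>. A point that is no midpoint is never lost.\<close>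

lemma level_lift:
  assumes "x \<notin> midpoints" "i < h m" "x \<in> lev m i"
  shows "\<exists>s\<in>subset_sums (\<lambda>j. h (m + j)) k. i + s < h (m + k) \<and> x \<in> lev (m + k) (i + s)"
proof (induction k)
  case 0
  then show ?case using assms by simp
next
  case (Suc k)
  then obtain s where s: "s \<in> subset_sums (\<lambda>j. h (m + j)) k" "i + s < h (m + k)"
    "x \<in> lev (m + k) (i + s)" by blast
  have "x \<in> lev (Suc (m + k)) (i + s) \<or> x \<in> lev (Suc (m + k)) (i + s + h (m + k))"
    using level_split[OF s(2)] s(3) assms(1) by blast
  then show ?case
  proof
    assume "x \<in> lev (Suc (m + k)) (i + s)"
    then show ?thesis
      using s height_Suc[of "m + k"] by (intro bexI[of _ s]) auto
  next
    assume "x \<in> lev (Suc (m + k)) (i + s + h (m + k))"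
    then show ?thesis
      using s height_Suc[of "m + k"] by (intro bexI[of _ "h (m + k) + s"]) (auto simp: ac_simps)
  qed
qed

section \<open>The limit map climbs the levels\<close>

lemma column_map_Suc:
  assumes "x \<notin> midpoints" "(x, y) \<in> column_map (C n)"
  shows "(x, y) \<in> column_map (C (Suc n))"
proof -
  obtain i where i: "Suc i < h n" "x \<in> lev n i" "y = x - base n i + base n (Suc i)"
    using assms(2) by (auto simp: column_map_def)
  \<comment> \<open>A level and its successor are cut alike, so the half containing \<open>x\<close>
    is moved by the same translation in the next column.\<close>
  have "x \<in> lev (Suc n) i \<or> x \<in> lev (Suc n) (i + h n)"
    using level_split[of i n] i assms(1) by auto
  then show ?thesis
  proof
    assume "x \<in> lev (Suc n) i"
    then show ?thesis
      using i height_Suc[of n] base_left[of i n] base_left[of "Suc i" n]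
      unfolding column_map_def by (intro CollectI exI[of _ x] exI[of _ i]) auto
  next
    assume "x \<in> lev (Suc n) (i + h n)"
    then show ?thesis
      using i height_Suc[of n] base_right[of i n] base_right[of "Suc i" n]
      unfolding column_map_def by (intro CollectI exI[of _ x] exI[of _ "i + h n"]) auto
  qed
qed

lemma column_map_mono:
  assumes "x \<notin> midpoints" "(x, y) \<in> column_map (C n)" "n \<le> n'"
  shows "(x, y) \<in> column_map (C n')"
  using assms(3)
proof (induction n' rule: dec_induct)
  case base
  show ?case by (rule assms(2))
next
  case (step n')
  then show ?case by (intro column_map_Suc[OF assms(1)])
qed

lemma column_map_functional:
  assumes "(x, y) \<in> column_map (C n)" "(x, z) \<in> column_map (C n)"
  shows "y = z"
proof -
  obtain i where i: "Suc i < h n" "x \<in> lev n i" "y = x - base n i + base n (Suc i)"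
    using assms(1) by (auto simp: column_map_def)
  obtain j where j: "Suc j < h n" "x \<in> lev n j" "z = x - base n j + base n (Suc j)"
    using assms(2) by (auto simp: column_map_def)
  have "i = j"
    using level_unique i(2) j(2) Suc_lessD[OF i(1)] Suc_lessD[OF j(1)] by blast
  then show ?thesis
    using i(3) j(3) by simp
qed

lemma rank_one_map_eq:
  assumes "x \<notin> midpoints" "Suc i < h n" "x \<in> lev n i"
  shows "T x = x - base n i + base n (Suc i)"
proof -
  let ?y = "x - base n i + base n (Suc i)"
  have y: "(x, ?y) \<in> column_map (C n)"
    using assms(2,3) by (auto simp: column_map_def)
  \<comment> \<open>Values from two columns are compared in the later one, whose map extends both at
    \<open>x\<close>.\<close>
  have unique: "z = ?y" if "(x, z) \<in> column_map (C n')" for z n'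
    using column_map_mono[OF assms(1) that, of "max n n'"]
      column_map_mono[OF assms(1) y, of "max n n'"] column_map_functional
    by (meson max.cobounded1 max.cobounded2)
  have "(THE z. (x, z) \<in> (\<Union>n. column_map (C n))) = ?y"
  proof (rule the_equality)
    show "(x, ?y) \<in> (\<Union>n. column_map (C n))"
      using y by blast
    show "z = ?y" if "(x, z) \<in> (\<Union>n. column_map (C n))" for z
      using that unique by blast
  qed
  moreover have "x \<in> Domain (\<Union>n. column_map (C n))"
    using y by blast
  ultimately show ?thesis
    by (simp add: rank_one_map_def)
qed

lemma rank_one_map_funpow:
  assumes "x \<notin> bad_points" "x \<in> lev n i" "i + k < h n"
  shows "(T ^^ k) x = x - base n i + base n (i + k)"
  using assms(3)
proof (induction k)
  case 0
  then show ?case by simp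
next
  case (Suc k)
  let ?z = "x - base n i + base n (i + k)"
  have "?z \<in> lev n (i + k)"
    using assms(2) by (auto simp: level_def)
  then have "T ?z = ?z - base n (i + k) + base n (Suc (i + k))"
    using Suc.prems translate_notin_midpoints[OF assms(1)] by (intro rank_one_map_eq) auto
  then show ?case
    using Suc by simp
qed

text \<open>The height of the image in a late column is computed twice: by climbing \<open>k\<close>
  levels from \<open>y\<close>, and by lifting from level \<open>p\<close>. Having this for all
  large \<open>n\<close> lets two returns be compared in one column.\<close>

lemma return_time_eq:
  assumes "p < h m" "q < h m" "y \<notin> bad_points" "y \<in> lev m q" "(T ^^ k) y \<in> lev m p"
  shows "\<exists>N. \<forall>n\<ge>N. \<exists>s\<in>subset_sums (\<lambda>j. h (m + j)) n. \<exists>t\<in>subset_sums (\<lambda>j. h (m + j)) n.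
           p + s = q + t + k"
proof (intro exI allI impI)
  \<comment> \<open>The threshold keeps \<open>y\<close> at least \<open>k\<close> levels below the
    top: \<open>q + k\<close> is less than a third of \<open>h (m + n)\<close>, and the digit sum
    \<open>t\<close> is at most a third.\<close>
  fix n assume n: "n \<ge> 3 * (h m + k)"
  let ?S = "subset_sums (\<lambda>j. h (m + j)) n"
  \<comment> \<open>Equal indices give the zero translation.\<close>
  have y: "y \<notin> midpoints"
    using translate_notin_midpoints[OF assms(3), of 0 0 0] by simp
  obtain t where t: "t \<in> ?S" "q + t < h (m + n)" "y \<in> lev (m + n) (q + t)"
    using level_lift[OF y assms(2,4)] by blast
  have "3 * t \<le> h (m + n)"
    using subset_sums_bound[of 0 "\<lambda>j. h (m + j)", OF _ _ t(1)] height_growth by simp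
  then have less: "q + t + k < h (m + n)"
    using n assms(2) height_ge[of "m + n"] by simp
  let ?x = "(T ^^ k) y"
  have x_eq: "?x = y - base (m + n) (q + t) + base (m + n) (q + t + k)"
    by (rule rank_one_map_funpow[OF assms(3) t(3) less])
  then have x_lev: "?x \<in> lev (m + n) (q + t + k)"
    using t(3) by (auto simp: level_def)
  have "?x \<notin> midpoints"
    using translate_notin_midpoints[OF assms(3)] x_eq by simp
  then obtain s where s: "s \<in> ?S" "p + s < h (m + n)" "?x \<in> lev (m + n) (p + s)"
    using level_lift assms(1,5) by blast
  then have "p + s = q + t + k"
    using level_unique x_lev less by blast
  then show "\<exists>s\<in>?S. \<exists>t\<in>?S. p + s = q + t + k"
    using s(1) t(1) by blast
qed

section \<open>The measure on the space\<close>

lemma open_space: "open X"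
  by (auto simp: levels_def level_def)

lemma sets_M: "A \<in> sets M \<longleftrightarrow> A \<in> sets borel \<and> A \<subseteq> X"
  using open_space by (simp add: rank_one_space_def sets_restrict_space_iff conj_commute)

lemma emeasure_M: "A \<subseteq> X \<Longrightarrow> emeasure M A = emeasure lborel A"
  using open_space unfolding rank_one_space_def by (intro emeasure_restrict_space) auto

lemma measure_M: "A \<subseteq> X \<Longrightarrow> measure M A = measure lborel A"
  by (simp add: measure_def emeasure_M)

text \<open>A countable set not contained in \<open>X\<close> is outside \<open>sets M\<close>,
  where \<open>emeasure\<close> has the default value 0.\<close>

lemma emeasure_countable:
  assumes "countable A"
  shows "emeasure M A = 0"
proof (cases "A \<in> sets M")
  case True
  then show ?thesis
    using assms by (simp add: sets_M emeasure_M emeasure_lborel_countable)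
qed (rule emeasure_notin_sets)

text \<open>A return from \<open>A\<close> to \<open>A\<close> gives \<open>k = s - t\<close>, a
  passage from \<open>B\<close> to \<open>A\<close> gives \<open>k + h m = s' - t'\<close>, with
  sums of heights from \<open>h (Suc m)\<close> on. Together they contradict
  \<open>subset_sums_separated\<close> for \<open>d = h m\<close>.\<close>

lemma half_level_returns_exclusive:
  assumes i: "i < h m"
    and A: "A \<subseteq> lev (Suc m) i" and B: "B \<subseteq> lev (Suc m) (i + h m)"
  shows "measure M (A \<inter> (T ^^ k) ` A) = 0 \<or> measure M (A \<inter> (T ^^ k) ` B) = 0"
proof (rule ccontr)
  assume contr: "\<not> ?thesis"
  \<comment> \<open>A set of nonzero measure is uncountable, so it is not covered by the image of
    the countable set \<open>bad_points\<close>.\<close>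
  have witness: "\<exists>y\<in>D. y \<notin> bad_points \<and> (T ^^ k) y \<in> A"
    if "measure M (A \<inter> (T ^^ k) ` D) \<noteq> 0" for D
  proof (rule ccontr)
    assume "\<not> ?thesis"
    then have "A \<inter> (T ^^ k) ` D \<subseteq> (T ^^ k) ` bad_points"
      by blast
    then have "countable (A \<inter> (T ^^ k) ` D)"
      using countable_bad_points countable_subset countable_image by metis
    then show False
      using that emeasure_countable by (simp add: measure_def)
  qed
  let ?g = "\<lambda>j. h (Suc m + j)"
  have h1: "i < h (Suc m)" "i + h m < h (Suc m)"
    using i height_Suc[of m] by auto
  obtain y where y: "y \<notin> bad_points" "y \<in> lev (Suc m) i" "(T ^^ k) y \<in> lev (Suc m) i"
    using witness[of A] contr A by blast
  obtain z where z: "z \<notin> bad_points" "z \<in> lev (Suc m) (i + h m)" "(T ^^ k) z \<in> lev (Suc m) i"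
    using witness[of B] contr A B by blast
  obtain N1 where N1: "\<forall>n\<ge>N1. \<exists>s\<in>subset_sums ?g n. \<exists>t\<in>subset_sums ?g n. i + s = i + t + k"
    using return_time_eq[OF h1(1) h1(1) y] by blast
  obtain N2 where N2: "\<forall>n\<ge>N2. \<exists>s\<in>subset_sums ?g n. \<exists>t\<in>subset_sums ?g n.
      i + s = (i + h m) + t + k"
    using return_time_eq[OF h1 z] by blast
  let ?S = "subset_sums ?g (max N1 N2)"
  obtain s t where st: "s \<in> ?S" "t \<in> ?S" "i + s = i + t + k"
    using N1 by (meson max.cobounded1)
  obtain s' t' where st': "s' \<in> ?S" "t' \<in> ?S" "i + s' = (i + h m) + t' + k"
    using N2 by (meson max.cobounded2)
  have "s + t' + h m \<noteq> t + s'"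
    by (rule subset_sums_separated[of "h m" ?g, OF height_pos _ _ st(1,2) st'(1,2)])
      (simp_all add: height_growth)
  then show False using st(3) st'(3) by simp
qed

section \<open>A level whose two halves both meet \<open>F\<close> in positive measure\<close>

lemma fmeasurable_level: "lev n i \<in> fmeasurable lborel"
  using width_pos[of n] by (intro fmeasurableI) (simp_all add: level_def)

lemma fmeasurable_Int_level: "F \<in> sets borel \<Longrightarrow> F \<inter> lev n i \<in> fmeasurable lborel"
  using fmeasurable_level by (subst Int_commute, intro fmeasurable_Int_fmeasurable) simp_all

lemma exists_level_positive:
  assumes "F \<in> sets M" "0 < emeasure M F"
  shows "\<exists>n i. i < h n \<and> 0 < measure lborel (F \<inter> lev n i)"
proof (rule ccontr)
  assume contr: "\<not> ?thesis"
  have F: "F \<in> sets borel" "F \<subseteq> X"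
    using assms(1) sets_M by auto
  have null: "F \<inter> lev n i \<in> null_sets lborel" if "i < h n" for n i
  proof -
    have "measure lborel (F \<inter> lev n i) = 0"
      using contr that by (meson antisym measure_nonneg not_less)
    then show ?thesis
      using fmeasurable_Int_level[OF F(1), of n i, THEN fmeasurableD]
        fmeasurable_Int_level[OF F(1), of n i, THEN emeasure_eq_measure2]
      by (simp add: null_sets_def)
  qed
  have "(\<Union>(n, i)\<in>{(n, i). i < h n}. F \<inter> lev n i) \<in> null_sets lborel"
    by (rule null_sets_UN') (auto intro: null)
  moreover have "F = (\<Union>(n, i)\<in>{(n, i). i < h n}. F \<inter> lev n i)"
    using F(2) by (fastforce simp: levels_def)
  ultimately show False
    using assms(2) F(2) by (simp add: emeasure_M null_sets_def)
qed

text \<open>Otherwise, at every cut of a level one half meets \<open>F\<close> in a null set and the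
  other half keeps all the mass of \<open>F\<close> in that level. A fixed positive mass would then
  sit in arbitrarily narrow levels.\<close>

lemma exists_level_halves_positive:
  assumes "F \<in> sets M" "0 < emeasure M F"
  shows "\<exists>m i. i < h m \<and> 0 < measure lborel (F \<inter> lev (Suc m) i)
    \<and> 0 < measure lborel (F \<inter> lev (Suc m) (i + h m))"
proof (rule ccontr)
  assume contr: "\<not> ?thesis"
  have F: "F \<in> sets borel"
    using assms(1) sets_M by auto
  obtain n0 i0 where i0: "i0 < h n0" "0 < measure lborel (F \<inter> lev n0 i0)"
    using exists_level_positive[OF assms] by blast
  let ?a = "measure lborel (F \<inter> lev n0 i0)"
  have large: "\<exists>i<h n. ?a \<le> measure lborel (F \<inter> lev n i)" if "n0 \<le> n" for n
    using that
  proof (induction n rule: dec_induct)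
    case base
    then show ?case using i0 by blast
  next
    case (step n)
    then obtain i where i: "i < h n" "?a \<le> measure lborel (F \<inter> lev n i)"
      by blast
    let ?L = "F \<inter> lev (Suc n) i" and ?R = "F \<inter> lev (Suc n) (i + h n)"
    have null: "F \<inter> midpoints \<in> null_sets lborel"
      using F countable_imp_null_set_lborel[OF countable_midpoints] by (intro null_set_Int1) auto
    have LR: "?L \<union> ?R \<in> fmeasurable lborel"
      using fmeasurable_Int_level[OF F] by (intro fmeasurable.Un)
    have "measure lborel (F \<inter> lev n i) \<le> measure lborel (?L \<union> ?R \<union> F \<inter> midpoints)"
    proof (rule measure_mono_fmeasurable)
      show "F \<inter> lev n i \<subseteq> ?L \<union> ?R \<union> F \<inter> midpoints"
        using level_split[OF i(1)] by blast
      show "F \<inter> lev n i \<in> sets lborel"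
        using F by (simp add: level_def)
      show "?L \<union> ?R \<union> F \<inter> midpoints \<in> fmeasurable lborel"
        by (rule fmeasurable.Un[OF LR fmeasurableI_null_sets[OF null]])
    qed
    also have "\<dots> = measure lborel (?L \<union> ?R)"
      using null LR by (intro measure_Un_null_set) auto
    also have "\<dots> \<le> measure lborel ?L + measure lborel ?R"
      by (intro measure_Un_le fmeasurableD fmeasurable_Int_level F)
    finally have "?a \<le> measure lborel ?L + measure lborel ?R"
      using i(2) by simp
    moreover have "measure lborel ?L = 0 \<or> measure lborel ?R = 0"
      using contr i(1) by (meson antisym measure_nonneg not_less)
    ultimately have "?a \<le> measure lborel ?L \<or> ?a \<le> measure lborel ?R"
      by linarith
    moreover have "i < h (Suc n)" "i + h n < h (Suc n)"
      using i(1) height_Suc[of n] by auto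
    ultimately show ?case
      by blast
  qed
  \<comment> \<open>At stage \<open>max n0 n\<close> the level is narrower than the mass
    \<open>?a\<close> it should contain.\<close>
  obtain n where n: "(1/2) ^ n < ?a"
    using real_arch_pow_inv[of ?a "1/2"] i0(2) by auto
  obtain i where "?a \<le> measure lborel (F \<inter> lev (max n0 n) i)"
    using large[of "max n0 n"] by auto
  also have "\<dots> \<le> measure lborel (lev (max n0 n) i)"
    using F fmeasurable_level fmeasurable_Int_level fmeasurableD
    by (intro measure_mono_fmeasurable) blast+
  also have "\<dots> = (1/2) ^ max n0 n"
    by (simp add: level_def width_eq power_one_over)
  also have "\<dots> \<le> (1/2) ^ n"
    by (intro power_decreasing) auto
  finally show False using n by simp
qed

section \<open>Failure of rational weak mixing\<close>

lemma not_rationally_weakly_mixing: "\<not> rationally_weakly_mixing M T"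
proof
  assume "rationally_weakly_mixing M T"
  then obtain F where F: "F \<in> sets M" "0 < emeasure M F" "emeasure M F < \<infinity>"
    and mixing: "\<forall>A\<in>sets M. \<forall>B\<in>sets M. A \<subseteq> F \<longrightarrow> B \<subseteq> F \<longrightarrow>
      (\<lambda>n. 1 / return_sequence M T F n * (\<Sum>k<n. \<bar>measure M (A \<inter> (T ^^ k) ` B)
        - measure M A * measure M B * return_rate M T F k\<bar>)) \<longlonglongrightarrow> 0"
    unfolding rationally_weakly_mixing_def by (elim bexE conjE)
  let ?u = "return_rate M T F" and ?a = "return_sequence M T F"
  obtain m i where i: "i < h m"
    and pos: "0 < measure lborel (F \<inter> lev (Suc m) i)"
      "0 < measure lborel (F \<inter> lev (Suc m) (i + h m))"
    using exists_level_halves_positive[OF F(1,2)] by blast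
  define A where "A = F \<inter> lev (Suc m) i"
  define B where "B = F \<inter> lev (Suc m) (i + h m)"
  have AB: "A \<in> sets M" "B \<in> sets M" "A \<subseteq> F" "B \<subseteq> F"
    using F(1) by (auto simp: A_def B_def sets_M level_def)
  have measure_pos: "0 < measure M A" "0 < measure M B"
    using pos AB by (auto simp: A_def B_def measure_M sets_M)
  \<comment> \<open>A common lower bound for the coefficients of \<open>?u k\<close> in the two
    deviations, for the pairs \<open>A\<close>, \<open>A\<close> and \<open>A\<close>,
    \<open>B\<close>.\<close>
  define \<delta> where "\<delta> = measure M A * min (measure M A) (measure M B)"
  have "0 < \<delta>"
    using measure_pos by (simp add: \<delta>_def)
  let ?dev = "\<lambda>D k. \<bar>measure M (A \<inter> (T ^^ k) ` D) - measure M A * measure M D * ?u k\<bar>"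
  have dev: "\<delta> * ?u k \<le> ?dev A k + ?dev B k" for k
  proof -
    have u: "0 \<le> ?u k"
      by (simp add: return_rate_def)
    have "\<delta> * ?u k \<le> measure M A * measure M A * ?u k" "\<delta> * ?u k \<le> measure M A * measure M B * ?u k"
      using u by (auto simp: \<delta>_def intro!: mult_right_mono mult_left_mono)
    \<comment> \<open>Where the measure of the intersection vanishes, the deviation is the full
      product term, which is at least \<open>\<delta> * ?u k\<close>.\<close>
    moreover have "measure M (A \<inter> (T ^^ k) ` A) = 0 \<or> measure M (A \<inter> (T ^^ k) ` B) = 0"
      using half_level_returns_exclusive[OF i, of A B k] by (auto simp: A_def B_def)
    ultimately show ?thesis
      by auto
  qed
  \<comment> \<open>The term for \<open>k = 0\<close> is already positive, being the reciprocal of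
    the finite positive measure of \<open>F\<close>.\<close>
  have a_pos: "0 < ?a n" if "0 < n" for n
  proof -
    have "0 < measure M F"
      using F by (simp add: measure_def enn2real_positive_iff)
    then have "0 < ?u 0"
      by (simp add: return_rate_def)
    also have "\<dots> \<le> ?a n"
      unfolding return_sequence_def
      using that by (intro member_le_sum) (auto simp: return_rate_def)
    finally show ?thesis .
  qed
  have "(\<lambda>n. 1 / ?a n * (\<Sum>k<n. ?dev A k) + 1 / ?a n * (\<Sum>k<n. ?dev B k)) \<longlonglongrightarrow> 0 + 0"
    by (rule tendsto_add[OF mixing[rule_format, OF AB(1,1,3,3)] mixing[rule_format, OF AB]])
  \<comment> \<open>Summing the pointwise bound over \<open>k < n\<close> and dividing by
    \<open>?a n\<close> keeps the sum of the two averages at least \<delta>, against its limit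
    0.\<close>
  moreover have "\<forall>\<^sub>F n in sequentially.
      \<delta> \<le> 1 / ?a n * (\<Sum>k<n. ?dev A k) + 1 / ?a n * (\<Sum>k<n. ?dev B k)"
    using eventually_gt_at_top[of 0]
  proof eventually_elim
    case (elim n)
    have "\<delta> * ?a n \<le> (\<Sum>k<n. ?dev A k + ?dev B k)"
      unfolding return_sequence_def sum_distrib_left by (intro sum_mono dev)
    then show ?case
      using a_pos[OF elim] by (simp add: field_simps sum.distrib)
  qed
  ultimately have "\<delta> \<le> 0 + 0"
    by (intro tendsto_lowerbound) auto
  then show False
    using \<open>0 < \<delta>\<close> by simp
qed

end

theorem theorem3p2:
  fixes C :: "nat \<Rightarrow> column" and r c :: "nat \<Rightarrow> nat" and s :: "nat \<Rightarrow> nat \<Rightarrow> nat"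
  assumes "rank_one_columns r s C"
    and "\<And>n. r n = 2"
    and "\<And>n. s n 0 = 0"
    and "\<And>n. s n 1 = c n"
    and "\<And>n. c n \<ge> 2 * height (C n)"
  shows "\<not> rationally_weakly_mixing (rank_one_space C) (rank_one_map C)"
proof -
  have cut: "cut_and_stack 2 (s n) (C n) (C (Suc n))" for n
    using assms(1,2) by (metis rank_one_columns_def)
  interpret cut_in_half C c
  proof
    show "C 0 = Column 1 [0]"
      using assms(1) by (simp add: rank_one_columns_def)
    fix n
    show "is_column (C (Suc n))" "width (C (Suc n)) = width (C n) / 2"
      using cut[of n] by (auto simp: cut_and_stack_def)
    show "2 * height (C n) \<le> c n"
      by (rule assms(5))
    obtain sp where "\<forall>k<2. length (sp k) = s n k"
      "bases (C (Suc n)) = concat (map (\<lambda>k. subcolumn 2 (C n) k @ sp k) [0..<2])"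
      using cut[of n] by (auto simp: cut_and_stack_def)
    \<comment> \<open>The list \<open>sp 0\<close> is empty because \<open>s n 0 = 0\<close>, so
      \<open>sp 1\<close> holds all new spacers.\<close>
    then show "\<exists>sp. length sp = c n \<and> bases (C (Suc n)) =
        bases (C n) @ map (\<lambda>b. b + width (C n) / 2) (bases (C n)) @ sp"
      using assms(3)[of n] assms(4)[of n]
      by (intro exI[of _ "sp 1"]) (auto simp: subcolumn_def numeral_2_eq_2)
  qed
  show ?thesis
    by (rule not_rationally_weakly_mixing)
qed

end
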